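(* Let $I=[-1,1]$ and let $\mathcal{S}=\{s_1,\ldots,s_r\}$ be a set of $r$ segments in $I$ that is unisolvent for $\mathbb{P}_{r-1}$, and let $\Pi_r(\mathcal{S}):L_\infty(I)\to\mathbb{P}_{r-1}$ be the corresponding interpolation operator. Then $$\|\Pi_r(\mathcal{S})\|_{\mathrm{op}}\leq\Lambda_r(\mathcal{S}).$$ If the segments in $\mathcal{S}$ are pairwise non-overlapping in the sense that $|s_i\cap s_j|=0$ for $i\neq j$, then equality $\|\Pi_r(\mathcal{S})\|_{\mathrm{op}}=\Lambda_r(\mathcal{S})$ holds.
   Context: $\mathbb{P}_{r-1}$ is the space of real polynomials of degree at most $r-1$. Segments are intervals $s_i=[\alpha_i,\beta_i]$ with $-1\le\alpha_i<\beta_i\le1$; $|\cdot|$ denotes length (Lebesgue measure). $\mathcal{S}$ is unisolvent for $\mathbb{P}_{r-1}$ if for every $(\mu_1,\ldots,\mu_r)\in\mathbb{R}^r$ there is a unique $p\in\mathbb{P}_{r-1}$ with $\int_{s_i}p(x)\,\mathrm{d}x=\mu_i$ for all $i$. In that case, $\{\ell_{s_j}\}_{j=1}^r\subset\mathbb{P}_{r-1}$ is the Lagrange basis determined by $\int_{s_i}\ell_{s_j}(x)\,\mathrm{d}x=\delta_{ij}$, and the interpolation operator is $\Pi_r(\mathcal{S})f=\sum_{i=1}^r\left(\int_{s_i}f(y)\,\mathrm{d}y\right)\ell_{s_i}$. The norm is $\|f\|=\mathrm{ess\,sup}_{x\in I}|f(x)|$, and $\|\Pi_r(\mathcal{S})\|_{\mathrm{op}}=\sup_{f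 \in L_\infty(I),\,\|f\|\le1}\|\Pi_r(\mathcal{S})f\|$. The (segmental) Lebesgue constant is $$\Lambda_r(\mathcal{S})=\sup_{-1\le a<b\le1}\frac{1}{b-a}\sum_{i=1}^r|s_i|\left|\int_a^b\ell_{s_i}(x)\,\mathrm{d}x\right|=\sup_{x\in I}\sum_{i=1}^r|s_i|\,|\ell_{s_i}(x)|.$$ *)

theory Defs
  imports
    "HOL-Analysis.Analysis"
    "HOL-Computational_Algebra.Polynomial"
    "HOL-Probability.Essential_Supremum"
begin

abbreviation base_interval :: "real set"  (\<open>\<I>\<close>)
  where "\<I> \<equiv> {-1..1}"

definition polys_upto :: "nat \<Rightarrow> real poly set"
  where "polys_upto n = {p. degree p \<le> n}"

definition is_segment :: "real set \<Rightarrow> bool"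
  where "is_segment s \<longleftrightarrow> (\<exists>\<alpha> \<beta>. -1 \<le> \<alpha> \<and> \<alpha> < \<beta> \<and> \<beta> \<le> 1 \<and> s = {\<alpha>..\<beta>})"

text \<open>
  A system \<open>S\<close> of segments is a set of sets of reals, so that data vectors and
  Lagrange basis polynomials are indexed by the segments themselves: a data vector is a function
  on \<open>S\<close>, and its values outside \<open>S\<close> play no role. The definitions are meant
  for \<open>card S = r\<close> and \<open>r \<ge> 1\<close>; at \<open>r = 0\<close> the natural number \<open>r - 1\<close> is truncated.
\<close>

definition unisolvent :: "nat \<Rightarrow> real set set \<Rightarrow> bool"
  where "unisolvent r S \<longleftrightarrow>
    (\<forall>\<mu> :: real set \<Rightarrow> real.
      \<exists>!p. p \<in> polys_upto (r - 1) \<and> (\<forall>s\<in>S. (LINT x:s|lebesgue. poly p x) = \<mu> s))"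

definition lagrange_basis :: "nat \<Rightarrow> real set set \<Rightarrow> real set \<Rightarrow> real poly"
  where "lagrange_basis r S s =
    (THE p. p \<in> polys_upto (r - 1) \<and>
      (\<forall>t\<in>S. (LINT x:t|lebesgue. poly p x) = (if t = s then 1 else 0)))"

definition interp_operator :: "nat \<Rightarrow> real set set \<Rightarrow> (real \<Rightarrow> real) \<Rightarrow> real poly"
  where "interp_operator r S f =
    (\<Sum>s\<in>S. smult (LINT y:s|lebesgue. f y) (lagrange_basis r S s))"

text \<open>
  Elements of \<open>L\<^sub>\<infinity>(\<I>)\<close> are represented by functions on the reals that are Lebesgue
  measurable and essentially bounded on \<open>\<I>\<close>; values outside \<open>\<I>\<close> are irrelevant. Suprema are
  taken in the extended reals, so that they are meaningful without a prior boundedness proof.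
\<close>

definition Linf_norm :: "(real \<Rightarrow> real) \<Rightarrow> ereal"
  where "Linf_norm f = esssup (lebesgue_on \<I>) (\<lambda>x. ereal \<bar>f x\<bar>)"

definition Linf :: "(real \<Rightarrow> real) set"
  where "Linf = {f. f \<in> borel_measurable (lebesgue_on \<I>) \<and> Linf_norm f < \<infinity>}"

definition Linf_op_norm :: "((real \<Rightarrow> real) \<Rightarrow> real poly) \<Rightarrow> ereal"
  where "Linf_op_norm T = (SUP f\<in>{f \<in> Linf. Linf_norm f \<le> 1}. Linf_norm (poly (T f)))"

definition lebesgue_const :: "nat \<Rightarrow> real set set \<Rightarrow> ereal"
  where "lebesgue_const r S =
    (SUP (a, b)\<in>{(a, b). -1 \<le> a \<and> a < b \<and> b \<le> 1}.
      ereal (1 / (b - a) *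
        (\<Sum>s\<in>S. measure lebesgue s * \<bar>LINT x:{a..b}|lebesgue. poly (lagrange_basis r S s) x\<bar>)))"

definition non_overlapping :: "real set set \<Rightarrow> bool"
  where "non_overlapping S \<longleftrightarrow> pairwise (\<lambda>s t. measure lebesgue (s \<inter> t) = 0) S"

end

theory Submission
  imports Defs
begin

text \<open>
  Everything rests on one way of computing the norm of a polynomial: by continuity,
  \<open>\<parallel>p\<parallel>\<close> is the supremum of the absolute averages of \<open>p\<close> over nondegenerate subintervals
  \<open>{a..b}\<close> of \<open>\<I>\<close> (lemma \<open>Linf_norm_poly_eq_SUP_average\<close>). The Lebesgue constant is a
  supremum over the same intervals, so the two quantities can be compared interval by interval.

  If \<open>\<parallel>f\<parallel> \<le> 1\<close>, the integral of \<open>f\<close> over a segment \<open>s\<close> is at most \<open>\<bar>s\<bar>\<close> in absolute value.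
  Writing the interpolant of \<open>f\<close> in the Lagrange basis and integrating it over \<open>{a..b}\<close>, the
  triangle inequality bounds its average by the quantity in the definition of the Lebesgue
  constant. This is the upper bound.

  For fixed \<open>a < b\<close> the triangle inequality is an equality as soon as the integral of \<open>f\<close> over
  every \<open>s\<close> is exactly \<open>\<sigma> s * \<bar>s\<bar>\<close>, where \<open>\<sigma> s\<close> is the sign of the integral of the basis polynomial of
  \<open>s\<close> over \<open>{a..b}\<close>. If the segments overlap only in null sets, the step function that is
  \<open>\<sigma> s\<close> almost everywhere on \<open>s\<close> and \<open>0\<close> outside all segments has these integrals and has
  norm at most \<open>1\<close>. So the operator norm is at least the quantity belonging to \<open>{a..b}\<close>, for
  every \<open>{a..b}\<close>, and hence at least the Lebesgue constant.
\<close>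

section \<open>Essential bounds and averages\<close>

lemma AE_abs_le_if_Linf_norm_le:
  assumes "Linf_norm f \<le> ereal c"
  shows "AE x in lebesgue_on \<I>. \<bar>f x\<bar> \<le> c"
  using esssup_AE[of "\<lambda>x. ereal \<bar>f x\<bar>" "lebesgue_on \<I>"]
proof eventually_elim
  case (elim x)
  then have "ereal \<bar>f x\<bar> \<le> ereal c"
    using assms unfolding Linf_norm_def by (rule order_trans)
  then show ?case by simp
qed

lemma abs_integral_le_if_AE_abs_le:
  fixes f :: "real \<Rightarrow> real"
  assumes f: "f \<in> borel_measurable (lebesgue_on \<I>)"
    and bound: "AE x in lebesgue_on \<I>. \<bar>f x\<bar> \<le> c"
    and ab: "-1 \<le> a" "a \<le> b" "b \<le> 1"
  shows "\<bar>LINT x:{a..b}|lebesgue. f x\<bar> \<le> c * (b - a)"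
proof -
  define g where "g x = indicator {a..b} x * f x" for x
  have "(\<lambda>x. indicator \<I> x *\<^sub>R f x) \<in> borel_measurable lebesgue"
    using f by (subst (asm) borel_measurable_restrict_space_iff) auto
  then have "(\<lambda>x. indicator {a..b} x * (indicator \<I> x *\<^sub>R f x)) \<in> borel_measurable lebesgue"
    by (intro borel_measurable_times borel_measurable_indicator) auto
  also have "(\<lambda>x. indicator {a..b} x * (indicator \<I> x *\<^sub>R f x)) = g"
    using ab by (auto simp: g_def indicator_def fun_eq_iff)
  finally have g: "g \<in> borel_measurable lebesgue" .
  have "AE x in lebesgue. x \<in> \<I> \<longrightarrow> \<bar>f x\<bar> \<le> c"
    using bound by (subst (asm) AE_restrict_space_iff) auto
  then have le: "AE x in lebesgue. norm (g x) \<le> c * indicator {a..b} x"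
    by eventually_elim (use ab in \<open>auto simp: g_def indicator_def\<close>)
  have int: "integrable lebesgue (\<lambda>x. c * indicator {a..b} x)"
    by (intro integrable_mult_right integrable_real_indicator) (auto simp: emeasure_lborel_Icc_eq)
  have "integrable lebesgue g"
    by (rule Bochner_Integration.integrable_bound[OF int g])
      (use le in eventually_elim, auto)
  then have "norm (integral\<^sup>L lebesgue g) \<le> (LINT x|lebesgue. c * indicator {a..b} x)"
    using int le by (intro order_trans[OF integral_norm_bound] integral_mono_AE) auto
  also have "\<dots> = c * (b - a)"
    using ab by simp
  finally show ?thesis
    by (simp add: set_lebesgue_integral_def g_def[abs_def])
qed

lemma set_integrable_poly:
  "set_integrable lebesgue {a..b} (poly p)" for p :: "real poly"
proof -
  have "set_integrable lborel {a..b} (poly p)"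
    by (intro borel_integrable_atLeastAtMost' continuous_intros)
  then show ?thesis
    unfolding set_integrable_def
    by (subst integrable_completion) (auto dest: borel_measurable_integrable)
qed

lemma borel_measurable_poly_lebesgue_on:
  "poly p \<in> borel_measurable (lebesgue_on A)" for p :: "real poly"
proof -
  have "poly p \<in> borel_measurable borel"
    by (intro borel_measurable_continuous_onI continuous_intros)
  then show ?thesis
    by (intro measurable_restrict_space1 measurable_completion) simp
qed

text \<open>
  A continuous function cannot exceed its averages: wherever \<open>\<bar>p\<bar>\<close> exceeds a level \<open>c\<close>, the
  sign of \<open>p\<close> is constant nearby, and short intervals have absolute average at least \<open>c\<close>.
\<close>

lemma ex_interval_large_average:
  fixes p :: "real poly"
  assumes x: "x \<in> \<I>" and c: "c < \<bar>poly p x\<bar>"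
  obtains a b where "-1 \<le> a" "a < b" "b \<le> 1"
    "c \<le> 1 / (b - a) * \<bar>LINT y:{a..b}|lebesgue. poly p y\<bar>"
proof -
  define \<sigma> where "\<sigma> = sgn (poly p x)"
  have "isCont (\<lambda>y. \<sigma> * poly p y) x"
    by (intro continuous_intros)
  moreover have "c < \<sigma> * poly p x"
    using c by (simp add: \<sigma>_def abs_sgn mult.commute)
  ultimately have "\<forall>\<^sub>F y in at x. c < \<sigma> * poly p y"
    by (auto simp: isCont_def intro: order_tendstoD(1))
  then obtain d where d: "d > 0" "\<And>y. y \<noteq> x \<Longrightarrow> dist y x < d \<Longrightarrow> c < \<sigma> * poly p y"
    unfolding eventually_at by blast
  have near: "c < \<sigma> * poly p y" if "dist y x < d" for y
    using d(2)[of y] that \<open>c < \<sigma> * poly p x\<close> by (cases "y = x") auto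
  define a b where "a = max (-1) (x - d / 2)" and "b = min 1 (x + d / 2)"
  have ab: "-1 \<le> a" "a < b" "b \<le> 1"
    using x d(1) by (auto simp: a_def b_def)
  have large: "c \<le> \<sigma> * poly p y" if "y \<in> {a..b}" for y
    using that d(1) by (intro less_imp_le near) (auto simp: a_def b_def dist_real_def)
  have "c * (b - a) = (LINT y:{a..b}|lebesgue. c)"
    using ab by (simp add: set_lebesgue_integral_def)
  also have "\<dots> \<le> (LINT y:{a..b}|lebesgue. \<sigma> * poly p y)"
  proof (rule set_integral_mono)
    show "set_integrable lebesgue {a..b} (\<lambda>y. c)"
      using set_integrable_poly[of a b "[:c:]"] by (simp add: set_integrable_def)
  qed (use large set_integrable_poly in auto)
  also have "\<dots> = \<sigma> * (LINT y:{a..b}|lebesgue. poly p y)"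
    by simp
  also have "\<dots> \<le> \<bar>LINT y:{a..b}|lebesgue. poly p y\<bar>"
    by (auto simp: \<sigma>_def sgn_if)
  finally have "c \<le> 1 / (b - a) * \<bar>LINT y:{a..b}|lebesgue. poly p y\<bar>"
    using ab by (simp add: field_simps)
  with ab that show thesis by blast
qed

text \<open>
  Averages are insensitive to null sets, hence bounded by the essential supremum, and
  conversely they detect every value of a continuous function.
\<close>

lemma Linf_norm_poly_eq_SUP_average:
  "Linf_norm (poly p) = (SUP (a, b)\<in>{(a, b). -1 \<le> a \<and> a < b \<and> b \<le> 1}.
     ereal (1 / (b - a) * \<bar>LINT x:{a..b}|lebesgue. poly p x\<bar>))" (is "_ = ?A")
proof (rule antisym)
  have "ereal \<bar>poly p x\<bar> \<le> ?A" if x: "x \<in> \<I>" for x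
  proof (rule ereal_le_real)
    fix z assume z: "?A \<le> ereal z"
    have "\<not> z < \<bar>poly p x\<bar>"
    proof
      assume "z < \<bar>poly p x\<bar>"
      then obtain c where c: "z < c" "c < \<bar>poly p x\<bar>"
        using dense by blast
      obtain a b where ab: "-1 \<le> a" "a < b" "b \<le> 1"
        "c \<le> 1 / (b - a) * \<bar>LINT y:{a..b}|lebesgue. poly p y\<bar>"
        using ex_interval_large_average[OF x c(2)] .
      have "ereal c \<le> ?A"
        by (rule SUP_upper2[of "(a, b)"]) (use ab in auto)
      with z c(1) show False
        by (meson ereal_less_eq(3) not_less order_trans)
    qed
    then show "ereal \<bar>poly p x\<bar> \<le> ereal z" by simp
  qed
  then show "Linf_norm (poly p) \<le> ?A"
    unfolding Linf_norm_def
    by (intro esssup_I AE_I2) (auto intro!: borel_measurable_ereal borel_measurable_abs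
      borel_measurable_poly_lebesgue_on simp: space_restrict_space)
next
  show "?A \<le> Linf_norm (poly p)"
  proof (rule SUP_least, clarify)
    fix a b :: real assume ab: "-1 \<le> a" "a < b" "b \<le> 1"
    show "ereal (1 / (b - a) * \<bar>LINT x:{a..b}|lebesgue. poly p x\<bar>) \<le> Linf_norm (poly p)"
    proof (rule ereal_le_real)
      fix z assume "Linf_norm (poly p) \<le> ereal z"
      then have "\<bar>LINT x:{a..b}|lebesgue. poly p x\<bar> \<le> z * (b - a)"
        using ab by (intro abs_integral_le_if_AE_abs_le AE_abs_le_if_Linf_norm_le
          borel_measurable_poly_lebesgue_on) auto
      then show "ereal (1 / (b - a) * \<bar>LINT x:{a..b}|lebesgue. poly p x\<bar>) \<le> ereal z"
        using ab by (simp add: field_simps)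
    qed
  qed
qed

section \<open>The interpolation operator\<close>

lemma integral_interp_operator:
  "(LINT x:{a..b}|lebesgue. poly (interp_operator r S f) x) =
    (\<Sum>s\<in>S. (LINT y:s|lebesgue. f y) * (LINT x:{a..b}|lebesgue. poly (lagrange_basis r S s) x))"
proof -
  have "(LINT x:{a..b}|lebesgue. poly (interp_operator r S f) x) =
    (LINT x|lebesgue. (\<Sum>s\<in>S. (LINT y:s|lebesgue. f y) *
      (indicator {a..b} x *\<^sub>R poly (lagrange_basis r S s) x)))"
    by (simp add: set_lebesgue_integral_def interp_operator_def poly_sum sum_distrib_left mult_ac)
  also have "\<dots> = (\<Sum>s\<in>S. LINT x|lebesgue. (LINT y:s|lebesgue. f y) *
      (indicator {a..b} x *\<^sub>R poly (lagrange_basis r S s) x))"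
    by (intro Bochner_Integration.integral_sum integrable_mult_right
      set_integrable_poly[unfolded set_integrable_def])
  finally show ?thesis
    by (simp add: set_lebesgue_integral_def)
qed

lemma Linf_op_norm_interp_le_lebesgue_const:
  assumes "\<And>s. s \<in> S \<Longrightarrow> is_segment s"
  shows "Linf_op_norm (interp_operator r S) \<le> lebesgue_const r S"
  unfolding Linf_op_norm_def
proof (rule SUP_least, clarify)
  fix f assume f: "f \<in> Linf" "Linf_norm f \<le> 1"
  have data: "\<bar>LINT y:s|lebesgue. f y\<bar> \<le> measure lebesgue s" if s: "s \<in> S" for s
  proof -
    obtain \<alpha> \<beta> where "-1 \<le> \<alpha>" "\<alpha> < \<beta>" "\<beta> \<le> 1" "s = {\<alpha>..\<beta>}"
      using assms[OF s] unfolding is_segment_def by blast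
    moreover have "AE x in lebesgue_on \<I>. \<bar>f x\<bar> \<le> 1"
      using f(2) by (intro AE_abs_le_if_Linf_norm_le) (simp add: one_ereal_def)
    ultimately show ?thesis
      using abs_integral_le_if_AE_abs_le[of f 1 \<alpha> \<beta>] f(1) by (simp add: Linf_def)
  qed
  show "Linf_norm (poly (interp_operator r S f)) \<le> lebesgue_const r S"
    unfolding Linf_norm_poly_eq_SUP_average lebesgue_const_def
  proof (rule SUP_mono, clarify)
    fix a b :: real assume ab: "-1 \<le> a" "a < b" "b \<le> 1"
    let ?J = "\<lambda>s. LINT x:{a..b}|lebesgue. poly (lagrange_basis r S s) x"
    have "\<bar>LINT x:{a..b}|lebesgue. poly (interp_operator r S f) x\<bar>
        \<le> (\<Sum>s\<in>S. \<bar>(LINT y:s|lebesgue. f y) * ?J s\<bar>)"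
      unfolding integral_interp_operator by (rule sum_abs)
    also have "\<dots> \<le> (\<Sum>s\<in>S. measure lebesgue s * \<bar>?J s\<bar>)"
      by (intro sum_mono) (auto simp: abs_mult intro!: mult_right_mono data)
    finally have "1 / (b - a) * \<bar>LINT x:{a..b}|lebesgue. poly (interp_operator r S f) x\<bar>
        \<le> 1 / (b - a) * (\<Sum>s\<in>S. measure lebesgue s * \<bar>?J s\<bar>)"
      using ab by (intro mult_left_mono) auto
    then show "\<exists>m\<in>{(a, b). -1 \<le> a \<and> a < b \<and> b \<le> 1}.
        ereal (1 / (b - a) * \<bar>LINT x:{a..b}|lebesgue. poly (interp_operator r S f) x\<bar>)
        \<le> (case m of (a, b) \<Rightarrow> ereal (1 / (b - a) *
          (\<Sum>s\<in>S. measure lebesgue s * \<bar>LINT x:{a..b}|lebesgue. poly (lagrange_basis r S s) x\<bar>)))"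
      using ab by (intro bexI[of _ "(a, b)"]) auto
  qed
qed

section \<open>Step functions on non-overlapping segments\<close>

definition step_fun :: "real set set \<Rightarrow> (real set \<Rightarrow> real) \<Rightarrow> real \<Rightarrow> real"
  where "step_fun S \<sigma> x = (\<Sum>s\<in>S. \<sigma> s * indicator s x)"

lemma lmeasurable_segment: "is_segment s \<Longrightarrow> s \<in> lmeasurable"
  unfolding is_segment_def by auto

lemma borel_measurable_step_fun:
  assumes "\<And>s. s \<in> S \<Longrightarrow> is_segment s"
  shows "step_fun S \<sigma> \<in> borel_measurable lebesgue"
  unfolding step_fun_def[abs_def]
  by (intro borel_measurable_sum borel_measurable_times borel_measurable_const
    borel_measurable_indicator) (auto dest: assms lmeasurable_segment)

lemma integral_step_fun:
  assumes S: "finite S" "\<And>s. s \<in> S \<Longrightarrow> is_segment s" "non_overlapping S" and s: "s \<in> S"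
  shows "(LINT x:s|lebesgue. step_fun S \<sigma> x) = \<sigma> s * measure lebesgue s"
proof -
  have inter: "integrable lebesgue (indicat_real (s \<inter> t))" if "t \<in> S" for t
  proof -
    have "s \<inter> t \<in> lmeasurable"
      using S(2) s that by (intro fmeasurable.Int lmeasurable_segment) auto
    then show ?thesis
      unfolding fmeasurable_def by (intro integrable_real_indicator) blast+
  qed
  have "(LINT x:s|lebesgue. step_fun S \<sigma> x) =
      (LINT x|lebesgue. (\<Sum>t\<in>S. \<sigma> t * indicator (s \<inter> t) x))"
    by (simp add: set_lebesgue_integral_def step_fun_def sum_distrib_left indicator_inter_arith mult_ac)
  also have "\<dots> = (\<Sum>t\<in>S. LINT x|lebesgue. \<sigma> t * indicator (s \<inter> t) x)"
    by (intro Bochner_Integration.integral_sum integrable_mult_right inter)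
  also have "\<dots> = (\<Sum>t\<in>S. \<sigma> t * measure lebesgue (s \<inter> t))"
    by simp
  also have "\<dots> = (\<Sum>t\<in>S. if t = s then \<sigma> s * measure lebesgue s else 0)"
    using S(3) s by (intro sum.cong) (auto simp: non_overlapping_def pairwise_def)
  also have "\<dots> = \<sigma> s * measure lebesgue s"
    using S(1) s by simp
  finally show ?thesis .
qed

text \<open>
  Off the null set where two segments meet, at most one summand of the step function is nonzero.
\<close>

lemma Linf_norm_step_fun_le_1:
  assumes S: "finite S" "\<And>s. s \<in> S \<Longrightarrow> is_segment s" "non_overlapping S"
    and \<sigma>: "\<And>s. s \<in> S \<Longrightarrow> \<bar>\<sigma> s\<bar> \<le> 1"
  shows "Linf_norm (step_fun S \<sigma>) \<le> 1"
proof -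
  have null: "AE x in lebesgue. x \<notin> s \<inter> t" if "s \<in> S" "t \<in> S" "s \<noteq> t" for s t
  proof -
    have "s \<inter> t \<in> lmeasurable"
      using S(2) that by (intro fmeasurable.Int lmeasurable_segment) auto
    moreover have "measure lebesgue (s \<inter> t) = 0"
      using S(3) that by (auto simp: non_overlapping_def pairwise_def)
    ultimately have "s \<inter> t \<in> null_sets lebesgue"
      by (auto simp: null_sets_def emeasure_eq_measure2)
    then show ?thesis by (rule AE_not_in)
  qed
  have "AE x in lebesgue. \<forall>s\<in>S. \<forall>t\<in>S. s \<noteq> t \<longrightarrow> x \<notin> s \<inter> t"
    by (intro AE_finite_allI S(1)) (use null in auto)
  then have "AE x in lebesgue. \<bar>step_fun S \<sigma> x\<bar> \<le> 1"
  proof eventually_elim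
    case (elim x)
    show ?case
    proof (cases "\<exists>s\<in>S. x \<in> s")
      case True
      then obtain s where s: "s \<in> S" "x \<in> s" by blast
      have "step_fun S \<sigma> x = (\<Sum>t\<in>S. if t = s then \<sigma> s else 0)"
        unfolding step_fun_def using elim s by (intro sum.cong) (auto simp: indicator_def)
      then show ?thesis using S(1) s \<sigma> by simp
    next
      case False
      then have "step_fun S \<sigma> x = 0"
        unfolding step_fun_def by (intro sum.neutral) (auto simp: indicator_def)
      then show ?thesis by simp
    qed
  qed
  then have "AE x in lebesgue_on \<I>. ereal \<bar>step_fun S \<sigma> x\<bar> \<le> 1"
    by (subst AE_restrict_space_iff) (auto elim: eventually_mono)
  moreover have "(\<lambda>x. ereal \<bar>step_fun S \<sigma> x\<bar>) \<in> borel_measurable (lebesgue_on \<I>)"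
    by (intro measurable_restrict_space1 borel_measurable_ereal borel_measurable_abs
      borel_measurable_step_fun S(2))
  ultimately show ?thesis
    unfolding Linf_norm_def by (intro esssup_I)
qed

text \<open>
  The test function depends on the interval \<open>{a..b}\<close>: its signs are chosen so that all terms of
  the integrated interpolant are nonnegative and add up without cancellation.
\<close>

lemma lebesgue_const_le_Linf_op_norm_interp:
  assumes S: "finite S" "\<And>s. s \<in> S \<Longrightarrow> is_segment s" "non_overlapping S"
  shows "lebesgue_const r S \<le> Linf_op_norm (interp_operator r S)"
  unfolding lebesgue_const_def
proof (rule SUP_least, clarify)
  fix a b :: real assume ab: "-1 \<le> a" "a < b" "b \<le> 1"
  let ?J = "\<lambda>s. LINT x:{a..b}|lebesgue. poly (lagrange_basis r S s) x"
  define f where "f = step_fun S (\<lambda>s. sgn (?J s))"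
  have norm_f: "Linf_norm f \<le> 1"
    unfolding f_def by (intro Linf_norm_step_fun_le_1 S) (auto simp: sgn_if)
  then have "Linf_norm f < \<infinity>"
    by (rule order.strict_trans1) simp
  then have f: "f \<in> Linf"
    using S(2) by (auto simp: Linf_def f_def
      intro: measurable_restrict_space1 borel_measurable_step_fun)
  have "(LINT x:{a..b}|lebesgue. poly (interp_operator r S f) x) =
      (\<Sum>s\<in>S. measure lebesgue s * \<bar>?J s\<bar>)"
    unfolding integral_interp_operator
    by (intro sum.cong) (simp_all add: f_def integral_step_fun[OF S] abs_sgn mult_ac)
  then have "ereal (1 / (b - a) * (\<Sum>s\<in>S. measure lebesgue s * \<bar>?J s\<bar>))
      \<le> ereal (1 / (b - a) * \<bar>LINT x:{a..b}|lebesgue. poly (interp_operator r S f) x\<bar>)"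
    using ab by (simp add: divide_right_mono)
  also have "\<dots> \<le> Linf_norm (poly (interp_operator r S f))"
    unfolding Linf_norm_poly_eq_SUP_average
    by (rule SUP_upper2[of "(a, b)"]) (use ab in auto)
  also have "\<dots> \<le> Linf_op_norm (interp_operator r S)"
    unfolding Linf_op_norm_def by (rule SUP_upper) (use f norm_f in auto)
  finally show "ereal (1 / (b - a) * (\<Sum>s\<in>S. measure lebesgue s * \<bar>?J s\<bar>))
      \<le> Linf_op_norm (interp_operator r S)" .
qed

section \<open>The operator norm and the Lebesgue constant\<close>

theorem theorem4p1:
  fixes r :: nat and S :: "real set set"
  assumes "r \<ge> 1"
    and "finite S" and "card S = r"
    and "\<And>s. s \<in> S \<Longrightarrow> is_segment s"
    and "unisolvent r S"
  shows "Linf_op_norm (interp_operator r S) \<le> lebesgue_const r S \<and>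
    (non_overlapping S \<longrightarrow> Linf_op_norm (interp_operator r S) = lebesgue_const r S)"
  using Linf_op_norm_interp_le_lebesgue_const[OF assms(4)]
    lebesgue_const_le_Linf_op_norm_interp[OF assms(2,4)]
  by (auto intro: antisym)

end
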